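(* Let $m$ be a natural number with $m>2$. Then $m$ is prime if and only if $$\prod_{j=1}^{m-1} (2^j + 1) \equiv 1 \pmod{2^m - 1}.$$ *)

theory Defs
  imports "HOL-Number_Theory.Number_Theory"
begin

end

theory Submission
  imports Defs
begin

text \<open>
  Write \<open>R\<^sub>n = 1 + x + \<dots> + x\<^sup>n\<^sup>-\<^sup>1\<close>. Since \<open>(x\<^sup>j + 1) R\<^sub>j = R\<^sub>2\<^sub>j\<close> and \<open>R\<^sub>j\<close> modulo \<open>R\<^sub>d\<close> depends only on
  \<open>j\<close> modulo \<open>d\<close>, for odd \<open>d\<close> doubling permutes the units modulo \<open>d\<close>, and the product of the
  \<open>x\<^sup>j + 1\<close> over \<open>j\<close> coprime to \<open>d\<close> is 1 modulo \<open>R\<^sub>d\<close>. For \<open>x = 2\<close> and \<open>d = m\<close> prime this is one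
  direction.

  Conversely, an even \<open>m\<close> is excluded by the common divisor \<open>2\<^sup>m\<^sup>/\<^sup>2 + 1\<close> of modulus and product. If
  \<open>m = p s\<close> is odd with \<open>p\<close> prime, reducing modulo \<open>2\<^sup>p - 1\<close> gives \<open>2\<^sup>s \<equiv> 2\<close>, so \<open>s \<equiv> 1\<close> modulo
  \<open>p\<close>; in particular \<open>m\<close> is squarefree. If \<open>m = p q s\<close> with primes \<open>p < q\<close>, reducing modulo
  \<open>N = (2\<^sup>p\<^sup>q - 1) / ((2\<^sup>p - 1) (2\<^sup>q - 1))\<close>, the value at 2 of a cyclotomic polynomial, gives
  \<open>2\<^sup>s \<equiv> 2\<close> again, and the size of \<open>N\<close> forces \<open>s \<equiv> 1\<close> modulo \<open>q\<close>. Together with \<open>p s \<equiv> 1\<close> modulo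
  \<open>q\<close> this yields \<open>p \<equiv> 1\<close> modulo \<open>q\<close>, contradicting \<open>p < q\<close>.
\<close>

section \<open>Repunits: reduction modulo one another and coprimality\<close>

definition repunit :: "int \<Rightarrow> nat \<Rightarrow> int" where
  "repunit x n = (\<Sum>i<n. x ^ i)"

lemma repunit_add: "repunit x (a + b) = repunit x a + x ^ a * repunit x b"
  by (induction b) (simp_all add: repunit_def power_add algebra_simps)

lemma power_diff_1_eq_repunit: "x ^ n - 1 = (x - 1) * repunit x n"
  by (simp add: repunit_def power_diff_1_eq)

lemma repunit_two: "repunit 2 n = 2 ^ n - 1"
  by (simp add: power_diff_1_eq_repunit)

lemma repunit_mult: "repunit x (k * n) = repunit x n * repunit (x ^ n) k"
proof (induction k)
  case (Suc k)
  then show ?case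
    using repunit_add [of x "k * n" n]
    by (simp add: repunit_def algebra_simps flip: power_mult)
qed (simp add: repunit_def)

lemma repunit_double: "repunit x (2 * n) = (x ^ n + 1) * repunit x n"
  by (simp add: mult_2 repunit_add distrib_right)

text \<open>Both \<open>repunit x (k * d)\<close> and \<open>x ^ (k * d) - 1\<close> are multiples
  of \<open>repunit x d\<close>, so splitting off \<open>k = n div d\<close> full periods with
  \<open>repunit_add\<close> leaves only the remainder term.\<close>

lemma repunit_cong_mod: "[repunit x n = repunit x (n mod d)] (mod repunit x d)"
proof -
  have "repunit x n = repunit x (n div d * d + n mod d)"
    by simp
  also have "\<dots> = repunit x (n mod d) +
      repunit x d * (repunit (x ^ d) (n div d) * (1 + (x - 1) * repunit x (n mod d)))"
  proof -
    have pow: "x ^ (n div d * d) = 1 + (x - 1) * (repunit x d * repunit (x ^ d) (n div d))"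
      using power_diff_1_eq_repunit [of x "n div d * d"] by (simp add: repunit_mult)
    show ?thesis
      unfolding repunit_add repunit_mult pow by (simp add: algebra_simps)
  qed
  finally show ?thesis
    by (simp add: cong_iff_dvd_diff)
qed

text \<open>An explicit inverse: if \<open>a * k\<close> is 1 modulo \<open>b\<close>, then
  \<open>repunit x a * repunit (x ^ a) k\<close> is the repunit of length \<open>k * a\<close>,
  which reduces to length 1.\<close>

lemma coprime_repunit:
  assumes "coprime a b" "b > 1"
  shows "coprime (repunit x a) (repunit x b)"
proof -
  obtain k where "[a * k = 1] (mod b)"
    using assms(1) cong_solve_coprime_nat by auto
  then have k: "(k * a) mod b = 1"
    using assms(2) by (simp add: cong_def mult.commute)
  have "[repunit x a * repunit (x ^ a) k = 1] (mod repunit x b)"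
    using repunit_cong_mod [of x "k * a" b] k by (simp add: repunit_mult) (simp add: repunit_def)
  then show ?thesis
    using coprime_iff_invertible_int by auto
qed

section \<open>Doubling on the units modulo an odd number\<close>

lemma bij_betw_double_totatives:
  assumes "odd d" "d > 1"
  shows "bij_betw (\<lambda>j. 2 * j mod d) (totatives d) (totatives d)"
proof -
  have inj: "inj_on (\<lambda>j. 2 * j mod d) (totatives d)"
  proof (rule inj_onI)
    fix i j assume ij: "i \<in> totatives d" "j \<in> totatives d" "2 * i mod d = 2 * j mod d"
    then have "[i = j] (mod d)"
      using assms(1) cong_mult_lcancel_nat [of 2 d i j] by (simp add: cong_def)
    moreover have "i < d" "j < d"
      using ij assms(2) totatives_less by auto
    ultimately show "i = j"
      by (simp add: cong_def)
  qed
  have "(\<lambda>j. 2 * j mod d) ` totatives d \<subseteq> totatives d"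
  proof safe
    fix j assume "j \<in> totatives d"
    then have "coprime (2 * j mod d) d"
      using assms by (simp add: in_totatives_iff)
    moreover from this have "2 * j mod d \<noteq> 0"
      using assms(2) by (intro notI) simp
    ultimately show "2 * j mod d \<in> totatives d"
      using assms(2) by (simp add: in_totatives_iff less_imp_le)
  qed
  with inj show ?thesis
    by (simp add: bij_betw_def endo_inj_surj)
qed

lemma prod_totatives_power_plus_1_cong:
  assumes "odd d" "d > 1"
  shows "[(\<Prod>j\<in>totatives d. x ^ j + 1) = 1] (mod repunit x d)"
proof -
  let ?Q = "\<Prod>j\<in>totatives d. repunit x j"
  have "(\<Prod>j\<in>totatives d. x ^ j + 1) * ?Q = (\<Prod>j\<in>totatives d. repunit x (2 * j))"
    by (simp add: repunit_double flip: prod.distrib)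
  also have "[\<dots> = (\<Prod>j\<in>totatives d. repunit x (2 * j mod d))] (mod repunit x d)"
    by (intro cong_prod repunit_cong_mod)
  also have "(\<Prod>j\<in>totatives d. repunit x (2 * j mod d)) = 1 * ?Q"
    using prod.reindex_bij_betw [OF bij_betw_double_totatives [OF assms], of "repunit x"] by simp
  finally have "[(\<Prod>j\<in>totatives d. x ^ j + 1) * ?Q = 1 * ?Q] (mod repunit x d)" .
  \<comment> \<open>Doubling has only permuted the factors of \<open>?Q\<close>; coprimality to the
    modulus allows cancelling it.\<close>
  moreover have "coprime ?Q (repunit x d)"
    using assms by (intro prod_coprime_left coprime_repunit) (auto simp: in_totatives_iff)
  ultimately show ?thesis
    using cong_mult_rcancel by blast
qed

lemma totatives_prime_eq:
  assumes "prime (p::nat)"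
  shows "totatives p = {1..<p}"
  using totatives_prime [OF assms] by auto

lemma prod_prime_power_plus_1_cong:
  assumes "prime p" "odd p"
  shows "[(\<Prod>j=1..<p. x ^ j + 1) = 1] (mod repunit x p)"
  using prod_totatives_power_plus_1_cong [of p x] assms prime_gt_1_nat
  by (simp add: totatives_prime_eq)

section \<open>Periodic products and powers of 2 modulo Mersenne numbers\<close>

text \<open>Modulo \<open>N\<close> the factor at \<open>j\<close> depends only on \<open>j\<close>
  modulo \<open>d\<close>. Adding the factor 2 at \<open>j = 0\<close> turns the range into
  \<open>s\<close> full blocks, each with product 2. The whole is thus \<open>2 ^ s\<close>, but by
  the second hypothesis also 2.\<close>

lemma prod_periodic_cong:
  fixes N :: int
  assumes "[2 ^ d = 1] (mod N)"
    and "[(\<Prod>j=1..<d*s. 2 ^ j + 1) = 1] (mod N)"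
    and "[(\<Prod>j=1..<d. 2 ^ j + 1) = 1] (mod N)"
    and "d > 0" "s > 0"
  shows "[2 ^ s = 2] (mod N)"
proof -
  have from0: "(\<Prod>j<n. (2::int) ^ j + 1) = 2 * (\<Prod>j=1..<n. 2 ^ j + 1)" if "n > 0" for n :: nat
    using that by (simp add: lessThan_atLeast0 prod.atLeast_Suc_lessThan)
  have block: "[(\<Prod>j=i*d..<i*d+d. (2::int) ^ j + 1) = 2] (mod N)" for i
  proof -
    have "(\<Prod>j=i*d..<i*d+d. (2::int) ^ j + 1) = (\<Prod>j<d. (2 ^ d) ^ i * 2 ^ j + 1)"
      using prod.shift_bounds_nat_ivl [of "\<lambda>j. (2::int) ^ j + 1" 0 "i * d" d]
      by (simp add: power_add lessThan_atLeast0 add.commute mult.commute flip: power_mult)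
    also have "[\<dots> = (\<Prod>j<d. 1 ^ i * 2 ^ j + 1)] (mod N)"
      using assms(1) by (intro cong_prod cong_add cong_mult cong_pow) auto
    also have "(\<Prod>j<d. (1::int) ^ i * 2 ^ j + 1) = 2 * (\<Prod>j=1..<d. 2 ^ j + 1)"
      using from0 [OF assms(4)] by simp
    also have "[\<dots> = 2 * 1] (mod N)"
      using assms(3) by (intro cong_mult) auto
    finally show ?thesis by simp
  qed
  have "[(\<Prod>i<s. \<Prod>j=i*d..<i*d+d. (2::int) ^ j + 1) = (\<Prod>i<s. 2)] (mod N)"
    using block by (intro cong_prod)
  then have "[2 ^ s = (\<Prod>j<d*s. (2::int) ^ j + 1)] (mod N)"
    by (simp add: prod.nat_group cong_sym mult.commute)
  also have "(\<Prod>j<d*s. (2::int) ^ j + 1) = 2 * (\<Prod>j=1..<d*s. 2 ^ j + 1)"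
    using assms by (intro from0) simp
  also have "[\<dots> = 2 * 1] (mod N)"
    using assms(2) by (intro cong_mult) auto
  finally show ?thesis by simp
qed

lemma power_two_cong_2_cancel:
  fixes N :: int
  assumes "[2 ^ s = 2] (mod N)" "odd N" "s > 0"
  shows "[2 ^ (s - 1) = 1] (mod N)"
proof -
  have "[2 * 2 ^ (s - 1) = 2 * 1] (mod N)"
    using assms by (simp flip: power_Suc)
  then show ?thesis
    by (rule cong_mult_lcancel [THEN iffD1, rotated]) (use assms(2) in simp)
qed

lemma mersenne_dvd_mersenne:
  assumes "a dvd b"
  shows "(2 ^ a - 1 :: int) dvd 2 ^ b - 1"
proof -
  obtain k where "b = k * a"
    using assms by (metis dvdE mult.commute)
  then show ?thesis
    using repunit_mult [of 2 k a] by (simp add: repunit_two)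
qed

text \<open>The exponent may be reduced modulo \<open>d\<close>; then
  \<open>2 ^ (n mod d) - 1\<close> is a nonnegative multiple of the larger \<open>2 ^ d - 1\<close>,
  hence 0.\<close>

lemma mersenne_dvd_imp_dvd:
  assumes "[2 ^ n = 1] (mod (2 ^ d - 1 :: int))" "d > 0"
  shows "d dvd n"
proof -
  have "[2 ^ n - 1 = 2 ^ (n mod d) - (1::int)] (mod (2 ^ d - 1))"
    using repunit_cong_mod [of 2 n d] by (simp add: repunit_two)
  moreover have "[2 ^ n - 1 = 1 - (1::int)] (mod (2 ^ d - 1))"
    using assms(1) by (intro cong_diff) auto
  ultimately have "[2 ^ (n mod d) - 1 = (0::int)] (mod (2 ^ d - 1))"
    by (metis cong_sym cong_trans diff_self)
  then have "(2 ^ d - 1 :: int) dvd 2 ^ (n mod d) - 1"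
    by (simp add: cong_0_iff)
  moreover have "(2 ^ (n mod d) - 1 :: int) < 2 ^ d - 1"
    using assms(2) by simp
  ultimately have "(2 ^ (n mod d) - 1 :: int) \<le> 0"
    using zdvd_imp_le [of "2 ^ d - 1" "2 ^ (n mod d) - 1"] by linarith
  then have "(2::int) ^ (n mod d) \<le> 2 ^ 0" by simp
  then have "n mod d = 0"
    by (subst (asm) power_increasing_iff) auto
  then show ?thesis by auto
qed

lemma cong_1_of_dvd_pred:
  assumes "d dvd s - 1" "s > (0::nat)"
  shows "[s = 1] (mod d)"
  using assms by (simp add: cong_altdef_nat cong_sym_eq)

lemma cofactor_prime_cong_1:
  assumes "prime p" "odd p" "s > 0"
    and "[(\<Prod>j=1..<p*s. 2 ^ j + 1) = 1] (mod (2 ^ (p*s) - 1 :: int))"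
  shows "[s = 1] (mod p)"
proof -
  have p: "p > 0" using assms(1) prime_gt_0_nat by blast
  have dvd: "(2 ^ p - 1 :: int) dvd 2 ^ (p*s) - 1"
    using mersenne_dvd_mersenne by auto
  have "[2 ^ s = 2] (mod (2 ^ p - 1 :: int))"
  proof (rule prod_periodic_cong)
    show "[2 ^ p = 1] (mod (2 ^ p - 1 :: int))"
      by (simp add: cong_iff_dvd_diff)
    show "[(\<Prod>j=1..<p*s. 2 ^ j + 1) = 1] (mod (2 ^ p - 1 :: int))"
      using assms(4) dvd cong_dvd_modulus by blast
    show "[(\<Prod>j=1..<p. 2 ^ j + 1) = 1] (mod (2 ^ p - 1 :: int))"
      using prod_prime_power_plus_1_cong [OF assms(1,2), of 2] by (simp add: repunit_two)
  qed (use p assms in auto)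
  then have "[2 ^ (s - 1) = 1] (mod (2 ^ p - 1 :: int))"
    using assms(3) p by (intro power_two_cong_2_cancel) auto
  then show ?thesis
    using mersenne_dvd_imp_dvd p assms(3) cong_1_of_dvd_pred by blast
qed

section \<open>Two distinct prime factors\<close>

text \<open>The three classes are the possible values 1, \<open>p\<close>, \<open>q\<close> of the
  gcd with \<open>p * q\<close>.\<close>

lemma atLeastLessThan_two_primes_split:
  assumes "prime (p::nat)" "prime q" "p \<noteq> q"
  shows "{1..<p*q} = totatives (p*q) \<union> ((*) p ` {1..<q} \<union> (*) q ` {1..<p})"
proof -
  have p: "p > 1" "q > 1" using assms prime_gt_1_nat by blast+
  then have pq: "p * q > 1" by (rule less_1_mult)
  have "j \<in> totatives (p*q) \<union> ((*) p ` {1..<q} \<union> (*) q ` {1..<p})" if "j \<in> {1..<p*q}" for j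
  proof (cases "p dvd j \<or> q dvd j")
    case True
    then show ?thesis using that p by (auto elim!: dvdE)
  next
    case False
    then have "coprime j (p * q)"
      using assms by (metis coprime_commute coprime_mult_right_iff prime_imp_coprime)
    then show ?thesis using that by (auto simp: in_totatives_iff)
  qed
  moreover have "totatives (p*q) \<subseteq> {1..<p*q}"
    using pq totatives_less by (auto simp: in_totatives_iff)
  moreover have "(*) p ` {1..<q} \<subseteq> {1..<p*q}" "(*) q ` {1..<p} \<subseteq> {1..<p*q}"
    using p by (auto simp: mult.commute)
  ultimately show ?thesis
    by blast
qed

text \<open>Each gcd class contributes 1. For the multiples of \<open>p\<close> this is the prime
  case for \<open>q\<close> at \<open>x = 2 ^ p\<close>, and symmetrically for \<open>q\<close>;
  \<open>N\<close> divides all three repunits involved.\<close>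

lemma prod_two_primes_power_plus_1_cong:
  assumes "prime p" "prime q" "odd p" "odd q" "p \<noteq> q"
    and N: "2 ^ (p * q) - 1 = N * ((2 ^ p - 1) * (2 ^ q - 1 :: int))"
  shows "[(\<Prod>j=1..<p*q. 2 ^ j + 1) = 1] (mod N)"
proof -
  have p: "p > 1" "q > 1" using assms prime_gt_1_nat by blast+
  then have pq: "p * q > 1" by (rule less_1_mult)
  have cop: "coprime p q" using assms primes_coprime by blast
  have p1: "(2 ^ p - 1 :: int) \<noteq> 0" "(2 ^ q - 1 :: int) \<noteq> 0" using p by auto
  have "(2 ^ p - 1) * repunit (2 ^ p) q = (2 ^ p - 1) * (N * (2 ^ q - 1))"
    using repunit_mult [of 2 q p] N unfolding repunit_two by (simp only: mult_ac)
  then have Nq: "N dvd repunit (2 ^ p) q" using p1 by simp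
  have "(2 ^ q - 1) * repunit (2 ^ q) p = (2 ^ q - 1) * (N * (2 ^ p - 1))"
    using repunit_mult [of 2 p q] N unfolding repunit_two by (simp only: mult_ac)
  then have Np: "N dvd repunit (2 ^ q) p" using p1 by simp
  have tot: "[(\<Prod>j\<in>totatives (p*q). 2 ^ j + 1) = 1] (mod N)"
    using prod_totatives_power_plus_1_cong [of "p * q" 2] pq assms(3,4) N
    by (simp add: repunit_two cong_modulus_mult)
  have mq: "[(\<Prod>j\<in>(*) p ` {1..<q}. 2 ^ j + 1) = 1] (mod N)"
    using cong_dvd_modulus [OF prod_prime_power_plus_1_cong [OF assms(2,4)] Nq] p
    by (simp add: prod.reindex inj_on_def power_mult)
  have mp: "[(\<Prod>j\<in>(*) q ` {1..<p}. 2 ^ j + 1) = 1] (mod N)"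
    using cong_dvd_modulus [OF prod_prime_power_plus_1_cong [OF assms(1,3)] Np] p
    by (simp add: prod.reindex inj_on_def power_mult)
  have disj: "(*) p ` {1..<q} \<inter> (*) q ` {1..<p} = {}"
  proof -
    have False if "p * i = q * j" "1 \<le> i" "i < q" for i j
    proof -
      have "q dvd p * i" using that by simp
      then have "q dvd i" using cop by (simp add: coprime_dvd_mult_right_iff coprime_commute)
      then show False using that by (simp add: nat_dvd_not_less)
    qed
    then show ?thesis by auto
  qed
  have disj': "totatives (p*q) \<inter> ((*) p ` {1..<q} \<union> (*) q ` {1..<p}) = {}"
    using p by (auto simp: in_totatives_iff)
  have "(\<Prod>j=1..<p*q. (2::int) ^ j + 1) = (\<Prod>j\<in>totatives (p*q). 2 ^ j + 1) *
      ((\<Prod>j\<in>(*) p ` {1..<q}. 2 ^ j + 1) * (\<Prod>j\<in>(*) q ` {1..<p}. 2 ^ j + 1))"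
    unfolding atLeastLessThan_two_primes_split [OF assms(1,2,5)]
    using disj disj' by (subst prod.union_disjoint; simp add: prod.union_disjoint)
  also have "[\<dots> = 1 * (1 * 1)] (mod N)"
    by (intro cong_mult tot mq mp)
  finally show ?thesis by simp
qed

text \<open>Bezout in the form \<open>a * u = b * v + gcd a b\<close> avoids negative exponents; it
  needs nonzero \<open>a\<close>.\<close>

lemma power_cong_1_gcd:
  fixes N :: int
  assumes "[2 ^ a = 1] (mod N)" "[2 ^ b = 1] (mod N)"
  shows "[2 ^ gcd a b = 1] (mod N)"
proof (cases "a = 0")
  case False
  then obtain u v where uv: "a * u = b * v + gcd a b"
    using bezout_nat by blast
  have "[1 ^ v * 2 ^ gcd a b = (2 ^ b) ^ v * 2 ^ gcd a b] (mod N)"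
    using assms by (intro cong_mult cong_pow) (auto simp: cong_sym)
  also have "(2 ^ b) ^ v * 2 ^ gcd a b = ((2::int) ^ a) ^ u"
    using uv by (simp flip: power_mult power_add)
  also have "[(2 ^ a) ^ u = 1 ^ u] (mod N)"
    using assms by (intro cong_pow)
  finally show ?thesis
    by simp
qed (use assms in simp)

lemma no_two_prime_factors:
  assumes "prime p" "prime q" "odd p" "p < q" "s > 0"
    and P: "[(\<Prod>j=1..<p*q*s. 2 ^ j + 1) = 1] (mod (2 ^ (p*q*s) - 1 :: int))"
    and odd: "odd (p * q * s)"
  shows False
proof -
  have oq: "odd q" using odd by simp
  have p: "p > 1" "q > 1" using assms prime_gt_1_nat by blast+
  have p3: "p \<ge> 3" using p assms(3) by (cases "p = 2") auto
  have cop: "coprime p q" using assms primes_coprime by blast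
  have "coprime (2 ^ p - 1) (2 ^ q - 1 :: int)"
    using coprime_repunit [OF cop, of 2] p by (simp add: repunit_two)
  moreover have "(2 ^ p - 1 :: int) dvd 2 ^ (p * q) - 1" "(2 ^ q - 1 :: int) dvd 2 ^ (p * q) - 1"
    using mersenne_dvd_mersenne by auto
  ultimately have "(2 ^ p - 1) * (2 ^ q - 1 :: int) dvd 2 ^ (p * q) - 1"
    using divides_mult by blast
  then obtain N :: int where N: "2 ^ (p * q) - 1 = N * ((2 ^ p - 1) * (2 ^ q - 1))"
    by (metis dvdE mult.commute)
  have "odd (2 ^ (p * q) - 1 :: int)" using p by simp
  then have oN: "odd N" using N by simp
  have Npq: "[2 ^ (p * q) = 1] (mod N)"
    using N by (simp add: cong_iff_dvd_diff)
  have "(2 ^ (p*q) - 1 :: int) dvd 2 ^ (p*q*s) - 1"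
    using mersenne_dvd_mersenne by auto
  then have "N dvd 2 ^ (p*q*s) - 1"
    using N by (metis dvd_triv_left dvd_trans)
  then have "[(\<Prod>j=1..<p*q*s. 2 ^ j + 1) = 1] (mod N)"
    using P cong_dvd_modulus by blast
  moreover have "[(\<Prod>j=1..<p*q. 2 ^ j + 1) = 1] (mod N)"
    using assms oq N by (intro prod_two_primes_power_plus_1_cong) auto
  ultimately have "[2 ^ s = 2] (mod N)"
    using Npq p assms(5) by (intro prod_periodic_cong [of "p * q"]) auto
  then have Ns: "[2 ^ (s - 1) = 1] (mod N)"
    using oN assms(5) by (rule power_two_cong_2_cancel)
  have "q dvd s - 1"
  proof (rule ccontr)
    \<comment> \<open>The gcd of the exponents \<open>s - 1\<close> and \<open>p * q\<close> would
      then divide \<open>p\<close>, so \<open>N\<close> would divide \<open>2 ^ p - 1\<close>, which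
      is too small.\<close>
    assume "\<not> q dvd s - 1"
    then have "coprime (s - 1) q"
      using assms(2) coprime_commute prime_imp_coprime by blast
    then have "gcd (s - 1) (p * q) dvd p"
      by (simp add: gcd_mult_right_right_cancel coprime_commute)
    then obtain k where k: "p = gcd (s - 1) (p * q) * k" ..
    have "[(2 ^ gcd (s - 1) (p * q)) ^ k = 1 ^ k] (mod N)"
      by (intro cong_pow power_cong_1_gcd Ns Npq)
    then have "[2 ^ p = 1] (mod N)"
      using k by (metis power_mult power_one)
    then have "N dvd 2 ^ p - 1"
      by (simp add: cong_iff_dvd_diff)
    then have "N \<le> 2 ^ p - 1"
      using p by (intro zdvd_imp_le) auto
    then have "2 ^ (p * q) - 1 \<le> (2 ^ p - 1) * ((2 ^ p - 1) * (2 ^ q - 1 :: int))"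
      unfolding N by (intro mult_right_mono) auto
    also have "\<dots> < 2 ^ p * 2 ^ p * 2 ^ q - 1"
    proof -
      have "(2::int) ^ 1 \<le> 2 ^ p" "(2::int) ^ 1 \<le> 2 ^ q" using p by (intro power_increasing; simp)+
      then have "(2 ^ p - 1) * (2 ^ p - 1) \<le> (2 ^ p * 2 ^ p - 1 :: int)"
        by (simp add: algebra_simps)
      then have "(2 ^ p - 1) * (2 ^ p - 1) * (2 ^ q - 1) \<le> (2 ^ p * 2 ^ p - 1) * (2 ^ q - 1 :: int)"
        by (intro mult_right_mono) auto
      moreover have "(2::int) * 2 \<le> 2 ^ p * 2 ^ p"
        using \<open>(2::int) ^ 1 \<le> 2 ^ p\<close> by (intro mult_mono) auto
      ultimately show ?thesis
        using \<open>(2::int) ^ 1 \<le> 2 ^ q\<close> by (simp add: algebra_simps)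
    qed
    also have "2 ^ p * 2 ^ p * 2 ^ q = (2::int) ^ (p + p + q)"
      by (simp add: power_add)
    finally have "(2::int) ^ (p * q) < 2 ^ (p + p + q)" by simp
    then have "p * q < p + p + q" by simp
    \<comment> \<open>Here \<open>3 \<le> p < q\<close> enters:
      \<open>2 * p + q < 3 * q \<le> p * q\<close>.\<close>
    moreover have "p + p + q \<le> p * q"
    proof -
      have "3 * q \<le> p * q" using p3 by simp
      then show ?thesis using assms(4) by linarith
    qed
    ultimately show False by simp
  qed
  then have s1: "[s = 1] (mod q)"
    using assms(5) cong_1_of_dvd_pred by blast
  \<comment> \<open>The single-prime result applied to \<open>q\<close>, whose cofactor is
    \<open>p * s\<close>.\<close>
  have "[p * s = 1] (mod q)"
    using P p assms oq by (intro cofactor_prime_cong_1) (auto simp: mult_ac)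
  moreover have "[p * s = p * 1] (mod q)"
    using s1 by (intro cong_mult) auto
  ultimately have "[p = 1] (mod q)"
    by (metis cong_sym cong_trans mult.right_neutral)
  then show False
    using p assms(4) by (simp add: cong_def)
qed

theorem theorem1:
  fixes m :: nat
  assumes "m > 2"
  shows "prime m \<longleftrightarrow> [(\<Prod>j = 1..m - 1. ((2::int) ^ j + 1)) = 1] (mod (2 ^ m - 1))"
proof -
  have ivl: "{1..m - 1} = {1..<m}" using assms by auto
  show ?thesis
    unfolding ivl
  proof
    assume "prime m"
    then have "odd m" using assms prime_odd_nat by blast
    then show "[(\<Prod>j=1..<m. ((2::int) ^ j + 1)) = 1] (mod (2 ^ m - 1))"
      using prod_prime_power_plus_1_cong [OF \<open>prime m\<close>, of 2] by (simp add: repunit_two)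
  next
    assume P: "[(\<Prod>j=1..<m. ((2::int) ^ j + 1)) = 1] (mod (2 ^ m - 1))"
    have "odd m"
    proof
      assume "even m"
      then obtain k where k: "m = 2 * k" ..
      \<comment> \<open>\<open>2 ^ m - 1\<close> factors as
        \<open>(2 ^ k + 1) * (2 ^ k - 1)\<close>. Since \<open>1 \<le> k < m\<close>, the first
        factor also occurs in the product, which would make it divide 1.\<close>
      have "(2 ^ k + 1 :: int) dvd 2 ^ m - 1"
        using repunit_double [of 2 k] k by (simp add: repunit_two)
      then have "[(\<Prod>j=1..<m. ((2::int) ^ j + 1)) = 1] (mod (2 ^ k + 1))"
        using P cong_dvd_modulus by blast
      moreover have "(2 ^ k + 1 :: int) dvd (\<Prod>j=1..<m. ((2::int) ^ j + 1))"
        using k assms by (intro dvd_prodI) auto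
      ultimately have "(2 ^ k + 1 :: int) dvd 1"
        using cong_dvd_iff cong_sym by blast
      then have "(2 ^ k + 1 :: int) \<le> 1" by (intro zdvd_imp_le) auto
      then show False by simp
    qed
    show "prime m"
    proof (rule ccontr)
      assume "\<not> prime m"
      obtain p where p: "prime p" "p dvd m"
        using assms prime_factor_nat [of m] by auto
      then obtain n where n: "m = p * n" by blast
      have "n \<noteq> 1" using p n \<open>\<not> prime m\<close> by auto
      then obtain q where q: "prime q" "q dvd n"
        using prime_factor_nat by blast
      then obtain s where s: "n = q * s" by blast
      have "n > 0" "s > 0" using n s assms by (auto intro!: Nat.gr0I)
      have odd: "odd p" "odd q" using n s \<open>odd m\<close> by auto
      \<comment> \<open>A repeated prime contradicts \<open>n\<close> being 1 modulo
        \<open>p\<close>; for distinct primes the smaller one takes the first role in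
        \<open>no_two_prime_factors\<close>.\<close>
      consider "p = q" | "p < q" | "q < p" by linarith
      then show False
      proof cases
        case 1
        have "[n = 1] (mod p)"
          using P p n odd \<open>n > 0\<close> by (intro cofactor_prime_cong_1) auto
        moreover have "p dvd n" using q 1 by simp
        ultimately have "p dvd 1" using cong_dvd_iff by blast
        then show False using p by simp
      next
        case 2
        then show False
          using no_two_prime_factors [of p q s] P p q n s odd \<open>s > 0\<close> \<open>odd m\<close> by (simp add: mult_ac)
      next
        case 3
        then show False
          using no_two_prime_factors [of q p s] P p q n s odd \<open>s > 0\<close> \<open>odd m\<close> by (simp add: mult_ac)
      qed
    qed
  qed
qed

end
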